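(* Let $k\ge 3$ be a fixed integer and let $V_k(x)=\sum_{n_1,\ldots,n_k\le x}\frac{n_1\cdots n_k}{[n_1,\ldots,n_k]}$. Then, as $x\to\infty$, $$x^k\ll V_k(x)\ll x^k(\log x)^{2^k-2}.$$
   Context: $[n_1,\ldots,n_k]$ denotes the least common multiple of the positive integers $n_1,\ldots,n_k$; the sum ranges over $k$-tuples of positive integers $\le x$. $f\ll g$ means $|f|\le c g$ for some constant $c>0$ (depending on $k$) and all sufficiently large $x$. *)

theory Defs
  imports Complex_Main "HOL-Library.FuncSet" "HOL-Library.Landau_Symbols"
begin

(* A k-tuple of positive integers <= x is an extensional function on {..<k}, so that
   each tuple is counted exactly once. *)
definition V :: "nat \<Rightarrow> real \<Rightarrow> real" where
  "V k x = (\<Sum>n \<in> {..<k} \<rightarrow>\<^sub>E {m::nat. 0 < m \<and> real m \<le> x}.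
              real (\<Prod>i<k. n i) / real (LCM i\<in>{..<k}. n i))"

end

(* Lower bound: every term of V is at least 1, because the lcm divides the product.

   Upper bound: let M be the lcm of the first k-1 entries. The last entry n contributes
   n / lcm(M,n) = gcd(M,n) / M, and the sum of gcd(M,n) over n \<le> x is at most x tau(M). Hence V k x
   is at most x^k times the sum of tau(M) / M over (k-1)-tuples. To bound the sum of
   tau(lcm)^j / lcm over m-tuples, peel off the last entry again: n = g b with g = gcd(M,n)
   and lcm(M,n) = M b, so submultiplicativity of tau trades one entry for the factor
   (sum over b \<le> x of tau(b)^j / b) \<le> H^(2^j), with H the harmonic sum, while j increases
   by one. The exponents add up to 2^j (2^m - 1), which is 2^k - 2 for m = k - 1, j = 1. *)
theory Submission imports Defs begin

section \<open>Submultiplicativity of the divisor function\<close>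

definition divisor_count :: "nat \<Rightarrow> nat" where
  "divisor_count n = card {d. d dvd n}"

text \<open>Every divisor of \<open>a * b\<close> is a divisor of \<open>a\<close> times a divisor
  of \<open>b\<close>, so multiplication maps the pairs of divisors onto a set containing all
  divisors of the product.\<close>

lemma divisor_count_mult_le:
  assumes "a > 0" "b > 0"
  shows "divisor_count (a * b) \<le> divisor_count a * divisor_count b"
proof -
  have "{d. d dvd a * b} \<subseteq> (\<lambda>(u, v). u * v) ` ({d. d dvd a} \<times> {d. d dvd b})"
    by (auto simp: image_iff elim!: dvd_productE)
  then have "card {d. d dvd a * b} \<le> card ({d. d dvd a} \<times> {d. d dvd b})"
    using assms by (intro surj_card_le) auto
  then show ?thesis
    by (simp add: divisor_count_def card_cartesian_product)
qed

lemma divisor_count_mult_power_le: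
  assumes "a > 0" "b > 0"
  shows "real (divisor_count (a * b)) ^ j \<le> real (divisor_count a) ^ j * real (divisor_count b) ^ j"
proof -
  have "real (divisor_count (a * b)) \<le> real (divisor_count a) * real (divisor_count b)"
    using divisor_count_mult_le[OF assms] by (metis of_nat_le_iff of_nat_mult)
  then show ?thesis
    by (metis of_nat_0_le_iff power_mono power_mult_distrib)
qed

section \<open>Sums of powers of the divisor function\<close>

lemma sum_le_sum_reindex:
  fixes h :: "'b \<Rightarrow> real"
  assumes "finite T" "inj_on p S" "p ` S \<subseteq> T"
    and "\<And>s. s \<in> S \<Longrightarrow> f s \<le> h (p s)" "\<And>t. t \<in> T \<Longrightarrow> 0 \<le> h t"
  shows "sum f S \<le> sum h T"
proof -
  have "sum f S \<le> (\<Sum>s\<in>S. h (p s))"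
    using assms by (intro sum_mono) auto
  also have "\<dots> = sum h (p ` S)"
    using assms by (simp add: sum.reindex)
  also have "\<dots> \<le> sum h T"
    using assms by (intro sum_mono2) auto
  finally show ?thesis .
qed

text \<open>One factor \<open>divisor_count b\<close> is spent on summing over the divisors d of b.
  Writing b = d e turns this into a sum over pairs with d e \<le> N. Submultiplicativity separates
  the variables, and dropping the constraint d e \<le> N leaves a full square.\<close>

lemma sum_divisor_count_power_step:
  fixes N j :: nat
  shows "(\<Sum>b=1..N. real (divisor_count b) ^ Suc j / real b)
           \<le> (\<Sum>b=1..N. real (divisor_count b) ^ j / real b)\<^sup>2"
proof -
  let ?t = "\<lambda>b. real (divisor_count b) ^ j / real b"
  let ?S = "Sigma {1..N} (\<lambda>b. {d. d dvd b})"
  have "(\<Sum>b=1..N. real (divisor_count b) ^ Suc j / real b) = (\<Sum>b=1..N. \<Sum>d | d dvd b. ?t b)"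
    by (simp add: divisor_count_def)
  also have "\<dots> = (\<Sum>(b, d) \<in> ?S. ?t b)"
    by (rule sum.Sigma) auto
  also have "\<dots> \<le> (\<Sum>(u, v) \<in> {1..N} \<times> {1..N}. ?t u * ?t v)"
  proof (rule sum_le_sum_reindex[where p = "\<lambda>(b, d). (d, b div d)"])
    show "inj_on (\<lambda>(b, d). (d, b div d)) ?S"
      by (auto simp: inj_on_def dvd_div_eq_iff)
    show "(\<lambda>(b, d). (d, b div d)) ` ?S \<subseteq> {1..N} \<times> {1..N}"
    proof clarify
      fix b d :: nat
      assume *: "b \<in> {1..N}" "d dvd b"
      then have "0 < d" "d \<le> b" "0 < b div d" "b div d \<le> b"
        by (auto intro: dvd_imp_le Nat.gr0I dvd_pos_nat simp: dvd_div_eq_0_iff)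
      with * show "d \<in> {1..N} \<and> b div d \<in> {1..N}" by (auto intro: le_trans[OF div_le_dividend])
    qed
    fix s assume "s \<in> ?S"
    then obtain b d where s: "s = (b, d)" "b \<in> {1..N}" "d dvd b" by auto
    then obtain e where e: "b = d * e" by auto
    then have "d > 0" "e > 0" using s by (auto intro: Nat.gr0I)
    then show "(case s of (b, d) \<Rightarrow> ?t b)
        \<le> (case (case s of (b, d) \<Rightarrow> (d, b div d)) of (u, v) \<Rightarrow> ?t u * ?t v)"
      using divisor_count_mult_power_le[of d e j] by (simp add: s e divide_right_mono)
  qed auto
  also have "\<dots> = (\<Sum>b=1..N. ?t b)\<^sup>2"
    by (simp add: power2_eq_square sum_product sum.cartesian_product)
  finally show ?thesis .
qed

lemma sum_divisor_count_power_le: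
  "(\<Sum>b=1..N. real (divisor_count b) ^ j / real b) \<le> (\<Sum>b=1..N. 1 / real b) ^ (2 ^ j)"
proof (induction j)
  case (Suc j)
  have "(\<Sum>b=1..N. real (divisor_count b) ^ Suc j / real b)
      \<le> (\<Sum>b=1..N. real (divisor_count b) ^ j / real b)\<^sup>2"
    by (rule sum_divisor_count_power_step)
  also have "\<dots> \<le> ((\<Sum>b=1..N. 1 / real b) ^ (2 ^ j))\<^sup>2"
    by (intro power_mono Suc sum_nonneg) auto
  finally show ?case
    by (simp add: power_mult[symmetric] mult.commute)
qed simp

text \<open>The entry n is determined by g = gcd(M,n) and b = n/g, while lcm(M,n) = M b does not
  depend on g. Hence the sum over the divisors g of M only contributes a factor
  \<open>divisor_count M\<close>, which raises the exponent to \<open>Suc j\<close>.\<close>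

lemma sum_divisor_count_lcm_le:
  fixes M N j :: nat
  assumes "M > 0"
  shows "(\<Sum>n=1..N. real (divisor_count (lcm M n)) ^ j / real (lcm M n))
    \<le> real (divisor_count M) ^ Suc j / real M * (\<Sum>b=1..N. real (divisor_count b) ^ j / real b)"
proof -
  let ?t = "\<lambda>b. real (divisor_count b) ^ j / real b"
  let ?p = "\<lambda>n. (gcd M n, n div gcd M n)"
  have "(\<Sum>n=1..N. ?t (lcm M n)) \<le> (\<Sum>(g, b) \<in> {d. d dvd M} \<times> {1..N}. ?t M * ?t b)"
  proof (rule sum_le_sum_reindex[where p = ?p])
    show "finite ({d. d dvd M} \<times> {1..N})" using assms by simp
    show "inj_on ?p {1..N}"
      by (rule inj_on_inverseI[where g = "\<lambda>(g, b). g * b"]) simp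
    show "?p ` {1..N} \<subseteq> {d. d dvd M} \<times> {1..N}"
    proof (rule image_subsetI)
      fix n assume n: "n \<in> {1..N}"
      then have "0 < n div gcd M n"
        by (auto intro!: Nat.gr0I simp: dvd_div_eq_0_iff)
      moreover have "n div gcd M n \<le> N" using n by (auto intro: le_trans[OF div_le_dividend])
      ultimately show "?p n \<in> {d. d dvd M} \<times> {1..N}" by auto
    qed
    fix n assume n: "n \<in> {1..N}"
    define b where "b = n div gcd M n"
    have "lcm M n = M * b"
      by (simp add: b_def lcm_nat_def div_mult_swap)
    moreover have "b > 0"
      using n by (auto intro!: Nat.gr0I simp: b_def dvd_div_eq_0_iff)
    ultimately show "?t (lcm M n) \<le> (case ?p n of (g, b) \<Rightarrow> ?t M * ?t b)"
      using divisor_count_mult_power_le[OF assms, of b j]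
      by (simp add: b_def[symmetric] divide_right_mono)
  qed auto
  also have "\<dots> = (\<Sum>g | g dvd M. \<Sum>b=1..N. ?t M * ?t b)"
    by (rule sum.cartesian_product[symmetric])
  also have "\<dots> = (\<Sum>g | g dvd M. ?t M * (\<Sum>b=1..N. ?t b))"
    by (simp only: sum_distrib_left)
  also have "\<dots> = real (divisor_count M) ^ Suc j / real M * (\<Sum>b=1..N. ?t b)"
    by (simp add: divisor_count_def)
  finally show ?thesis .
qed

section \<open>Peeling off the last entry of a tuple\<close>

lemma sum_PiE_lessThan_Suc:
  fixes F :: "(nat \<Rightarrow> 'a) \<Rightarrow> real"
  shows "(\<Sum>n \<in> {..<Suc m} \<rightarrow>\<^sub>E A. F n) = (\<Sum>n \<in> {..<m} \<rightarrow>\<^sub>E A. \<Sum>a\<in>A. F (n(m := a)))"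
proof -
  have "{..<Suc m} \<rightarrow>\<^sub>E A = (\<lambda>(a, n). n(m := a)) ` (A \<times> ({..<m} \<rightarrow>\<^sub>E A))"
    by (simp add: lessThan_Suc PiE_insert_eq)
  moreover have "inj_on (\<lambda>(a, n). n(m := a)) (A \<times> ({..<m} \<rightarrow>\<^sub>E A))"
    by (rule inj_combinator) simp
  ultimately have "(\<Sum>n \<in> {..<Suc m} \<rightarrow>\<^sub>E A. F n)
      = (\<Sum>(a, n) \<in> A \<times> ({..<m} \<rightarrow>\<^sub>E A). F (n(m := a)))"
    by (simp add: sum.reindex case_prod_unfold)
  also have "\<dots> = (\<Sum>a\<in>A. \<Sum>n \<in> {..<m} \<rightarrow>\<^sub>E A. F (n(m := a)))"
    by (rule sum.cartesian_product[symmetric])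
  also have "\<dots> = (\<Sum>n \<in> {..<m} \<rightarrow>\<^sub>E A. \<Sum>a\<in>A. F (n(m := a)))"
    by (rule sum.swap)
  finally show ?thesis .
qed

lemma Lcm_fun_upd_Suc:
  fixes n :: "nat \<Rightarrow> nat"
  shows "(LCM i\<in>{..<Suc m}. (n(m := a)) i) = lcm (LCM i\<in>{..<m}. n i) a"
proof -
  have "(n(m := a)) ` {..<Suc m} = insert a (n ` {..<m})"
    by (auto simp: lessThan_Suc)
  then show ?thesis
    by (simp add: Lcm_insert lcm.commute)
qed

lemma prod_fun_upd_Suc:
  fixes n :: "nat \<Rightarrow> nat"
  shows "(\<Prod>i<Suc m. (n(m := a)) i) = (\<Prod>i<m. n i) * a"
proof -
  have "(\<Prod>i<m. (n(m := a)) i) = (\<Prod>i<m. n i)"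
    by (rule prod.cong) auto
  then show ?thesis by simp
qed

lemma Lcm_PiE_pos:
  fixes n :: "nat \<Rightarrow> nat"
  assumes "n \<in> {..<m} \<rightarrow>\<^sub>E {1..N}"
  shows "(LCM i\<in>{..<m}. n i) > 0"
proof -
  have "0 \<notin> n ` {..<m}"
    using assms by (force simp: PiE_iff)
  then show ?thesis
    by (intro Nat.gr0I) (simp add: Lcm_0_iff)
qed

lemma sum_divisor_count_Lcm_le:
  "(\<Sum>n \<in> {..<m} \<rightarrow>\<^sub>E {1..N}.
      real (divisor_count (LCM i\<in>{..<m}. n i)) ^ j / real (LCM i\<in>{..<m}. n i))
    \<le> (\<Sum>b=1..N. 1 / real b) ^ (2 ^ j * (2 ^ m - 1))"
proof (induction m arbitrary: j)
  case 0
  \<comment> \<open>There is exactly one empty tuple and its lcm is 1, so both sides equal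
    1.\<close>
  then show ?case by (simp add: divisor_count_def)
next
  case (Suc m)
  let ?H = "\<Sum>b=1..N. 1 / real b" and ?P = "{..<m} \<rightarrow>\<^sub>E {1..N}"
  let ?D = "\<Sum>b=1..N. real (divisor_count b) ^ j / real b"
  let ?M = "\<lambda>n :: nat \<Rightarrow> nat. LCM i\<in>{..<m}. n i"
  have "(\<Sum>n \<in> {..<Suc m} \<rightarrow>\<^sub>E {1..N}.
          real (divisor_count (LCM i\<in>{..<Suc m}. n i)) ^ j / real (LCM i\<in>{..<Suc m}. n i))
      = (\<Sum>n\<in>?P. \<Sum>a=1..N. real (divisor_count (lcm (?M n) a)) ^ j / real (lcm (?M n) a))"
    by (simp only: sum_PiE_lessThan_Suc Lcm_fun_upd_Suc)
  also have "\<dots> \<le> (\<Sum>n\<in>?P. real (divisor_count (?M n)) ^ Suc j / real (?M n) * ?D)"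
    by (intro sum_mono sum_divisor_count_lcm_le Lcm_PiE_pos)
  also have "\<dots> = (\<Sum>n\<in>?P. real (divisor_count (?M n)) ^ Suc j / real (?M n)) * ?D"
    by (rule sum_distrib_right[symmetric])
  also have "\<dots> \<le> ?H ^ (2 ^ Suc j * (2 ^ m - 1)) * ?H ^ (2 ^ j)"
    by (intro mult_mono Suc sum_divisor_count_power_le zero_le_power sum_nonneg) auto
  also have "\<dots> = ?H ^ (2 ^ j * (2 ^ Suc m - 1))"
  proof -
    \<comment> \<open>The subtraction is truncated, so 1 \<le> 2 ^ m is supplied before
      expanding.\<close>
    have "2 ^ Suc j * (2 ^ m - 1) + 2 ^ j = (2 ^ j * (2 * 2 ^ m - 1) :: nat)"
      using one_le_power[of "2::nat" m] by (simp add: diff_mult_distrib2)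
    then show ?thesis
      by (simp only: power_add[symmetric] power_Suc)
  qed
  finally show ?case .
qed

text \<open>Each summand is gcd(M,n) / M. Bounding the gcd by the sum of all common divisors allows
  the order of summation to be swapped. At most N/g of the n \<le> N are multiples of g, so each
  divisor g of M contributes at most N/M.\<close>

lemma sum_div_lcm_le:
  fixes M N :: nat
  assumes "M > 0"
  shows "(\<Sum>n=1..N. real n / real (lcm M n)) \<le> real N * (real (divisor_count M) / real M)"
proof -
  have *: "real n / real (lcm M n) \<le> (\<Sum>g | g dvd M. if g dvd n then real g / real M else 0)"
    if "n \<in> {1..N}" for n
  proof -
    have "real (gcd M n) * real (lcm M n) = real M * real n"
      by (metis of_nat_mult prod_gcd_lcm_nat)
    then have "real n / real (lcm M n) = real (gcd M n) / real M"
      using that assms by (simp add: field_simps lcm_pos_nat)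
    \<comment> \<open>The gcd is written as a one-element sum so that enlarging the index set only
      adds nonnegative terms.\<close>
    also have "\<dots> = (\<Sum>g \<in> {gcd M n}. if g dvd n then real g / real M else 0)"
      by simp
    also have "\<dots> \<le> (\<Sum>g | g dvd M. if g dvd n then real g / real M else 0)"
      using assms by (intro sum_mono2) auto
    finally show ?thesis .
  qed
  have card: "real (card {n\<in>{1..N}. g dvd n}) * real g \<le> real N" if "g dvd M" for g
  proof -
    have "g > 0" using that assms by (auto intro: Nat.gr0I)
    then have "{n\<in>{1..N}. g dvd n} \<subseteq> (\<lambda>q. g * q) ` {1..N div g}"
      by (auto simp: image_iff less_eq_div_iff_mult_less_eq mult.commute intro!: Nat.gr0I elim!: dvdE)
    then have "card {n\<in>{1..N}. g dvd n} \<le> card {1..N div g}"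
      by (intro surj_card_le) auto
    then have "card {n\<in>{1..N}. g dvd n} * g \<le> N div g * g"
      by simp
    also have "\<dots> \<le> N" by simp
    finally show ?thesis unfolding of_nat_mult[symmetric] of_nat_le_iff .
  qed
  have "(\<Sum>n=1..N. real n / real (lcm M n))
      \<le> (\<Sum>n=1..N. \<Sum>g | g dvd M. if g dvd n then real g / real M else 0)"
    by (intro sum_mono *)
  also have "\<dots> = (\<Sum>g | g dvd M. \<Sum>n=1..N. if g dvd n then real g / real M else 0)"
    by (rule sum.swap)
  also have "\<dots> = (\<Sum>g | g dvd M. real (card {n\<in>{1..N}. g dvd n}) * real g / real M)"
    by (simp add: sum.If_cases Int_def)
  also have "\<dots> \<le> (\<Sum>g | g dvd M. real N / real M)"
    by (intro sum_mono divide_right_mono card) auto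
  also have "\<dots> = real N * (real (divisor_count M) / real M)"
    by (simp add: divisor_count_def)
  finally show ?thesis .
qed

section \<open>Explicit bounds for \<open>V\<close>\<close>

lemma V_eq:
  assumes "x \<ge> 0"
  shows "V k x = (\<Sum>n \<in> {..<k} \<rightarrow>\<^sub>E {1..nat \<lfloor>x\<rfloor>}.
                    real (\<Prod>i<k. n i) / real (LCM i\<in>{..<k}. n i))"
proof -
  have "{m::nat. 0 < m \<and> real m \<le> x} = {1..nat \<lfloor>x\<rfloor>}"
    using assms by (auto simp: le_nat_floor) linarith
  then show ?thesis by (simp add: V_def)
qed

lemma V_Suc_le:
  assumes "x \<ge> 0"
  shows "V (Suc m) x \<le> x ^ Suc m * (\<Sum>b=1..nat \<lfloor>x\<rfloor>. 1 / real b) ^ (2 ^ Suc m - 2)"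
proof -
  define N where "N = nat \<lfloor>x\<rfloor>"
  have N: "real N \<le> x" using assms by (simp add: N_def)
  let ?P = "{..<m} \<rightarrow>\<^sub>E {1..N}" and ?M = "\<lambda>n :: nat \<Rightarrow> nat. LCM i\<in>{..<m}. n i"
  have "V (Suc m) x = (\<Sum>n\<in>?P. \<Sum>a=1..N. real (\<Prod>i<m. n i) * (real a / real (lcm (?M n) a)))"
    unfolding V_eq[OF assms] N_def[symmetric] sum_PiE_lessThan_Suc Lcm_fun_upd_Suc
      prod_fun_upd_Suc of_nat_mult times_divide_eq_right ..
  also have "\<dots> = (\<Sum>n\<in>?P. real (\<Prod>i<m. n i) * (\<Sum>a=1..N. real a / real (lcm (?M n) a)))"
    by (simp only: sum_distrib_left)
  also have "\<dots> \<le> (\<Sum>n\<in>?P. real N ^ m * (real N * (real (divisor_count (?M n)) / real (?M n))))"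
  proof (rule sum_mono, rule mult_mono)
    fix n assume n: "n \<in> ?P"
    show "(\<Sum>a=1..N. real a / real (lcm (?M n) a)) \<le> real N * (real (divisor_count (?M n)) / real (?M n))"
      using n by (intro sum_div_lcm_le Lcm_PiE_pos)
    have "real (n i) \<le> real N" if "i < m" for i
      using PiE_mem[OF n, of i] that by simp
    then have "(\<Prod>i<m. real (n i)) \<le> (\<Prod>i<m. real N)"
      by (intro prod_mono) simp
    then show "real (\<Prod>i<m. n i) \<le> real N ^ m" by simp
    show "0 \<le> (\<Sum>a=1..N. real a / real (lcm (?M n) a))"
      by (rule sum_nonneg) simp
  qed simp
  \<comment> \<open>The exponent 1 is displayed so that \<open>sum_divisor_count_Lcm_le\<close>
    applies with \<open>j = 1\<close>.\<close>
  also have "\<dots> = real N ^ Suc m * (\<Sum>n\<in>?P. real (divisor_count (?M n)) ^ 1 / real (?M n))"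
    unfolding sum_distrib_left power_one_right power_Suc
    by (rule sum.cong) (simp_all only: mult_ac)
  also have "\<dots> \<le> x ^ Suc m * (\<Sum>b=1..N. 1 / real b) ^ (2 ^ 1 * (2 ^ m - 1))"
    using assms N by (intro mult_mono power_mono sum_divisor_count_Lcm_le sum_nonneg) auto
  also have "\<dots> = x ^ Suc m * (\<Sum>b=1..N. 1 / real b) ^ (2 ^ Suc m - 2)"
    by (simp add: diff_mult_distrib2)
  finally show ?thesis by (simp only: N_def)
qed

text \<open>Telescoping: ln t \<le> t - 1 at t = N/(N+1) bounds 1/(N+1) by the increment of the
  logarithm from N to N+1.\<close>

lemma harmonic_sum_le_ln:
  assumes "N \<ge> 1"
  shows "(\<Sum>b=1..N. 1 / real b) \<le> 1 + ln (real N)"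
  using assms
proof (induction N rule: dec_induct)
  case (step N)
  have "ln (real N / real (Suc N)) \<le> real N / real (Suc N) - 1"
    using step by (intro ln_le_minus_one) auto
  then have "1 / real (Suc N) \<le> ln (real (Suc N)) - ln (real N)"
    using step by (simp add: ln_div field_simps)
  then show ?case using step by simp
qed simp

lemma card_le_V:
  assumes "x \<ge> 0"
  shows "real (nat \<lfloor>x\<rfloor>) ^ k \<le> V k x"
proof -
  let ?P = "{..<k} \<rightarrow>\<^sub>E {1..nat \<lfloor>x\<rfloor>}"
  have "real (nat \<lfloor>x\<rfloor>) ^ k = (\<Sum>n\<in>?P. 1)"
    by (simp add: card_PiE)
  also have "\<dots> \<le> V k x"
    unfolding V_eq[OF assms]
  proof (rule sum_mono)
    fix n assume n: "n \<in> ?P"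
    have "(LCM i\<in>{..<k}. n i) dvd (\<Prod>i<k. n i)"
      by (auto intro!: Lcm_least dvd_prodI)
    moreover have "(\<Prod>i<k. n i) > 0"
      using n by (intro prod_pos) (force simp: PiE_iff)
    ultimately have "(LCM i\<in>{..<k}. n i) \<le> (\<Prod>i<k. n i)"
      by (rule dvd_imp_le)
    then have "real (LCM i\<in>{..<k}. n i) \<le> real (\<Prod>i<k. n i)"
      by (simp only: of_nat_le_iff)
    then show "1 \<le> real (\<Prod>i<k. n i) / real (LCM i\<in>{..<k}. n i)"
      using Lcm_PiE_pos[OF n] by (subst le_divide_eq_1_pos) auto
  qed
  finally show ?thesis .
qed

section \<open>Passage to the asymptotic statement\<close>

theorem theorem5:
  fixes k :: nat
  assumes "k \<ge> 3"
  shows "(\<lambda>x::real. x ^ k) \<in> O[at_top](V k)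
       \<and> V k \<in> O[at_top](\<lambda>x::real. x ^ k * ln x ^ (2 ^ k - 2))"
proof
  show "(\<lambda>x::real. x ^ k) \<in> O[at_top](V k)"
  proof (rule bigoI[where c = "2 ^ k"])
    show "\<forall>\<^sub>F x in at_top. norm (x ^ k) \<le> 2 ^ k * norm (V k x)"
      using eventually_ge_at_top[of 2]
    proof eventually_elim
      case (elim x)
      \<comment> \<open>Rounding down loses less than 1, which is at most the floor itself here;
        this factor 2 per entry gives the constant 2 ^ k.\<close>
      have "x \<le> 2 * real (nat \<lfloor>x\<rfloor>)" using elim by linarith
      then have "x ^ k \<le> 2 ^ k * real (nat \<lfloor>x\<rfloor>) ^ k"
        using elim by (metis power_mono power_mult_distrib order_trans zero_le_numeral)
      also have "\<dots> \<le> 2 ^ k * V k x"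
        using elim by (intro mult_left_mono card_le_V) auto
      also have "\<dots> \<le> 2 ^ k * norm (V k x)" by simp
      finally show ?case using elim by simp
    qed
  qed
  show "V k \<in> O[at_top](\<lambda>x::real. x ^ k * ln x ^ (2 ^ k - 2))"
  proof (rule bigoI[where c = "2 ^ (2 ^ k - 2)"])
    show "\<forall>\<^sub>F x in at_top. norm (V k x) \<le> 2 ^ (2 ^ k - 2) * norm (x ^ k * ln x ^ (2 ^ k - 2))"
      \<comment> \<open>From e on, ln x \<ge> 1, so 1 + ln x \<le> 2 ln x; the factor 2 raised to
        the power 2 ^ k - 2 is the constant.\<close>
      using eventually_ge_at_top[of "exp 1"]
    proof eventually_elim
      case (elim x)
      let ?H = "\<Sum>b=1..nat \<lfloor>x\<rfloor>. 1 / real b"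
      have x: "x \<ge> 1" using elim one_le_exp_iff[of "1::real"] by linarith
      have ln: "1 \<le> ln x" using elim x by (subst ln_ge_iff) auto
      have N: "1 \<le> nat \<lfloor>x\<rfloor>" "real (nat \<lfloor>x\<rfloor>) \<le> x" using x by linarith+
      have "?H \<le> 1 + ln (real (nat \<lfloor>x\<rfloor>))" by (rule harmonic_sum_le_ln[OF N(1)])
      also have "\<dots> \<le> 1 + ln x" using N by (intro add_left_mono ln_mono) auto
      also have "\<dots> \<le> 2 * ln x" using ln by simp
      finally have H: "?H \<le> 2 * ln x" .
      have V0: "0 \<le> V k x" unfolding V_def by (intro sum_nonneg divide_nonneg_nonneg of_nat_0_le_iff)
      have "V k x \<le> x ^ k * ?H ^ (2 ^ k - 2)"
        using V_Suc_le[of x "k - 1"] x assms by simp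
      also have "\<dots> \<le> x ^ k * (2 * ln x) ^ (2 ^ k - 2)"
        using x H by (intro mult_left_mono power_mono sum_nonneg) auto
      finally show ?case
        using x ln V0 by (simp add: power_mult_distrib abs_mult mult_ac)
    qed
  qed
qed

end
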